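(* Let $0<q<1$, $\lambda,\alpha\in\mathbb{R}$, and let $x>0$. Define the fractional $q$-Laguerre function by $$L_{\lambda}^{\alpha}(x;q)=\frac{(1-q)^\lambda(-x;q)_{\infty}}{(q;q)_\lambda\,x^\alpha}\,D_q^{\lambda}\left[\frac{x^{\alpha+\lambda}}{(-x;q)_{\infty}}\right],$$ whenever the series defining $D_q^\lambda$ converges. Then, whenever it is defined, $$L_{\lambda}^{\alpha}(x;q)=\frac{1}{(q;q)_\lambda}\;{}_2\phi_1\!\left(\begin{matrix}q^{-\lambda},\,-x\\ 0\end{matrix}\,\middle|\,q;q^{\alpha+\lambda+1}\right).$$
   Context: Notation: $(s;q)_n=\prod_{j=0}^{n-1}(1-sq^j)$, $(s;q)_\infty=\prod_{j=0}^\infty(1-sq^j)$, and for real $\mu$, $(s;q)_\mu=\frac{(s;q)_\infty}{(sq^\mu;q)_\infty}$, with $\frac1{(q;q)_\lambda}=\frac{(q^{\lambda+1};q)_\infty}{(q;q)_\infty}$. The basic hypergeometric series is $${}_2\phi_1\!\left(\begin{matrix}a_1,a_2\\ b_1\end{matrix}\,\middle|\,q;z\right)=\sum_{n=0}^\infty\frac{(a_1;q)_n(a_2;q)_n}{(b_1;q)_n}\frac{z^n}{(q;q)_n},\qquad (0;q)_n=1.$$ The fractional $q$-derivative of order $\lambda$ is $$(D_q^{\lambda}f)(x)=\frac{1}{x^{\lambda}(1-q)^{\lambda}}\sum_{n=0}^{\infty}\frac{(q^{-\lambda};q)_n}{(q;q)_n}q^n f(q^n x),$$ whenever the series converges. 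*)

theory Defs
  imports "HOL-Analysis.Analysis"
begin

definition qpoch :: "real \<Rightarrow> real \<Rightarrow> nat \<Rightarrow> real" where
  "qpoch s q n = (\<Prod>j<n. 1 - s * q ^ j)"

definition qpoch_inf :: "real \<Rightarrow> real \<Rightarrow> real" where
  "qpoch_inf s q = (\<Prod>j. 1 - s * q ^ j)"

definition qpoch_real :: "real \<Rightarrow> real \<Rightarrow> real \<Rightarrow> real" where
  "qpoch_real s q \<mu> = qpoch_inf s q / qpoch_inf (s * q powr \<mu>) q"

text \<open>
  For a negative integer \<open>lam\<close>, \<open>qpoch_real q q lam\<close> has a pole, and its reciprocal is to be read
  as \<open>0\<close>.  Since \<open>x / 0 = 0\<close> in HOL, \<open>1 / qpoch_real q q lam\<close> has the intended value for every
  real \<open>lam\<close>: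
\<close>

lemma inverse_qpoch_real:
  assumes "0 < q"
  shows "1 / qpoch_real q q lam = qpoch_inf (q powr (lam + 1)) q / qpoch_inf q q"
  using assms by (simp add: qpoch_real_def powr_add mult.commute)

definition phi21_term :: "real \<Rightarrow> real \<Rightarrow> real \<Rightarrow> real \<Rightarrow> real \<Rightarrow> nat \<Rightarrow> real" where
  "phi21_term a1 a2 b1 q z n =
     qpoch a1 q n * qpoch a2 q n / qpoch b1 q n * (z ^ n / qpoch q q n)"

definition phi21 :: "real \<Rightarrow> real \<Rightarrow> real \<Rightarrow> real \<Rightarrow> real \<Rightarrow> real" where
  "phi21 a1 a2 b1 q z = (\<Sum>n. phi21_term a1 a2 b1 q z n)"

definition qderiv_term :: "real \<Rightarrow> real \<Rightarrow> (real \<Rightarrow> real) \<Rightarrow> real \<Rightarrow> nat \<Rightarrow> real" where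
  "qderiv_term q lam f x n =
     qpoch (q powr (- lam)) q n / qpoch q q n * q ^ n * f (q ^ n * x)"

definition qderiv :: "real \<Rightarrow> real \<Rightarrow> (real \<Rightarrow> real) \<Rightarrow> real \<Rightarrow> real" where
  "qderiv q lam f x =
     1 / (x powr lam * (1 - q) powr lam) * (\<Sum>n. qderiv_term q lam f x n)"

definition laguerre_arg :: "real \<Rightarrow> real \<Rightarrow> real \<Rightarrow> real \<Rightarrow> real" where
  "laguerre_arg q lam \<alpha> t = t powr (\<alpha> + lam) / qpoch_inf (- t) q"

definition qLaguerre_defined :: "real \<Rightarrow> real \<Rightarrow> real \<Rightarrow> real \<Rightarrow> bool" where
  "qLaguerre_defined q lam \<alpha> x \<longleftrightarrow> summable (qderiv_term q lam (laguerre_arg q lam \<alpha>) x)"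

text \<open>Meaningful only under \<open>qLaguerre_defined q lam \<alpha> x\<close>.\<close>

definition qLaguerre :: "real \<Rightarrow> real \<Rightarrow> real \<Rightarrow> real \<Rightarrow> real" where
  "qLaguerre q lam \<alpha> x =
     (1 - q) powr lam * qpoch_inf (- x) q / (qpoch_real q q lam * x powr \<alpha>)
       * qderiv q lam (laguerre_arg q lam \<alpha>) x"

end

theory Submission
  imports Defs
begin

text \<open>The two series agree term by term up to one constant. Splitting off n factors gives
  (-x;q)_n (-q^n x;q)_inf = (-x;q)_inf, so evaluating the differentiated function at q^n x produces
  exactly the factor (-x;q)_n over the fixed denominator (-x;q)_inf (\<open>qpoch_inf_split\<close>,
  \<open>qderiv_term_laguerre_arg\<close>). The constant is nonzero, so convergence passes to the
  2phi1 series, and the prefactors of the Laguerre function cancel it.\<close>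

lemma convergent_prod_qpoch_inf:
  fixes q x :: real
  assumes "0 < q" "q < 1" "x > 0"
  shows "convergent_prod (\<lambda>j. 1 - (- x) * q ^ j)"
proof -
  have "summable (\<lambda>j. norm (1 + x * q ^ j - 1))"
    using assms by (simp add: abs_mult summable_mult summable_geometric)
  then have "abs_convergent_prod (\<lambda>j. 1 + x * q ^ j)"
    by (simp add: abs_convergent_prod_conv_summable)
  then show ?thesis
    by (simp add: abs_convergent_prod_imp_convergent_prod)
qed

lemma one_plus_power_nonzero:
  fixes q x :: real
  assumes "0 < q" "x > 0"
  shows "1 - (- x) * q ^ j \<noteq> 0"
proof -
  have "x * q ^ j > 0" using assms by simp
  then show ?thesis by simp
qed

text \<open>A product convergent in the sense of \<open>convergent_prod\<close> can vanish only if
  some factor does, and for x > 0 every factor exceeds 1.\<close>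

lemma qpoch_inf_nonzero:
  assumes "0 < q" "q < 1" "x > 0"
  shows "qpoch_inf (- x) q \<noteq> 0"
  unfolding qpoch_inf_def
  using prodinf_nonzero[OF convergent_prod_qpoch_inf[OF assms]]
    one_plus_power_nonzero[OF assms(1,3)] by blast

lemma qpoch_inf_split:
  assumes "0 < q" "q < 1" "x > 0"
  shows "qpoch_inf (- x) q = qpoch (- x) q n * qpoch_inf (- (q ^ n * x)) q"
proof -
  have "qpoch_inf (- (q ^ n * x)) q = (\<Prod>j. 1 - (- x) * q ^ (j + n))"
    unfolding qpoch_inf_def by (simp add: power_add mult_ac)
  also have "\<dots> = qpoch_inf (- x) q / qpoch (- x) q n"
    unfolding qpoch_def qpoch_inf_def
    using prodinf_split_initial_segment[OF convergent_prod_qpoch_inf[OF assms], of n]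
      one_plus_power_nonzero[OF assms(1,3)]
    by (simp add: nonzero_eq_divide_eq power_add mult_ac)
  \<comment> \<open>Since \<open>a / 0 = 0\<close>, a nonzero tail forces the finite product to be
    nonzero, so the quotient can be multiplied out.\<close>
  finally show ?thesis
    using qpoch_inf_nonzero[OF assms(1,2), of "q ^ n * x"] assms by auto
qed

lemma qderiv_term_laguerre_arg:
  assumes "0 < q" "q < 1" "x > 0"
  shows "qderiv_term q lam (laguerre_arg q lam \<alpha>) x n =
    x powr (\<alpha> + lam) / qpoch_inf (- x) q *
    phi21_term (q powr (- lam)) (- x) 0 q (q powr (\<alpha> + lam + 1)) n"
proof -
  \<comment> \<open>The argument of the 2phi1: the weight q^n of the q-derivative supplies the
    \<open>+ 1\<close> in the exponent, the power of q^n x the rest.\<close>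
  have "(q powr (\<alpha> + lam + 1)) ^ n = q ^ n * (q ^ n) powr (\<alpha> + lam)"
    using assms by (simp add: powr_powr powr_add power_mult_distrib mult_ac flip: powr_realpow)
  moreover have "(q ^ n * x) powr (\<alpha> + lam) = (q ^ n) powr (\<alpha> + lam) * x powr (\<alpha> + lam)"
    using assms by (simp add: powr_mult)
  moreover have "1 / qpoch_inf (- (q ^ n * x)) q = qpoch (- x) q n / qpoch_inf (- x) q"
    using qpoch_inf_split[OF assms, of n] qpoch_inf_nonzero[OF assms]
    by (auto simp: field_simps)
  moreover have "qpoch 0 q n = 1"
    by (simp add: qpoch_def)
  ultimately show ?thesis
    unfolding qderiv_term_def laguerre_arg_def phi21_term_def
    by (simp add: divide_inverse mult_ac)
qed

theorem proposition13:
  fixes q lam \<alpha> x :: real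
  assumes "0 < q" and "q < 1" and "x > 0"
    and "qLaguerre_defined q lam \<alpha> x"
  shows "summable (phi21_term (q powr (- lam)) (- x) 0 q (q powr (\<alpha> + lam + 1))) \<and>
    qLaguerre q lam \<alpha> x =
      1 / qpoch_real q q lam * phi21 (q powr (- lam)) (- x) 0 q (q powr (\<alpha> + lam + 1))"
proof -
  let ?t = "phi21_term (q powr (- lam)) (- x) 0 q (q powr (\<alpha> + lam + 1))"
  define P where "P = qpoch_inf (- x) q"
  define c where "c = x powr (\<alpha> + lam) / P"
  have P: "P \<noteq> 0"
    using qpoch_inf_nonzero assms by (simp add: P_def)
  then have c: "c \<noteq> 0"
    using assms by (simp add: c_def)
  have terms: "qderiv_term q lam (laguerre_arg q lam \<alpha>) x = (\<lambda>n. c * ?t n)"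
    using qderiv_term_laguerre_arg assms by (auto simp: c_def P_def)
  have summable: "summable ?t"
    using assms(4) c by (simp add: qLaguerre_defined_def terms summable_cmult_iff)
  have "qLaguerre q lam \<alpha> x =
      (1 - q) powr lam * P / (qpoch_real q q lam * x powr \<alpha>) *
      (1 / (x powr lam * (1 - q) powr lam) * (c * suminf ?t))"
    by (simp add: qLaguerre_def qderiv_def terms P_def suminf_mult[OF summable])
  \<comment> \<open>Only \<open>P\<close> and the powers of x and 1 - q are cancelled.
    \<open>qpoch_real q q lam\<close> may be 0, for a negative integer \<open>lam\<close>; both
    sides are then 0.\<close>
  also have "\<dots> = 1 / qpoch_real q q lam * suminf ?t"
    using P assms by (simp add: c_def powr_add)
  finally show ?thesis
    using summable by (simp add: phi21_def)
qed

end
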